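(* Let $S$ be an Arf numerical semigroup with multiplicity $6$ and conductor $c$. In each list below, a parameter $t$ or $u$ concerns only the forms in which it appears. (i) If $c\equiv 0\pmod 6$, then $S$ equals one of the following: $\langle 6,c+1,c+2,c+3,c+4,c+5\rangle$, $\langle 6,6u+2,6u+4,c+1,c+3,c+5\rangle$, $\langle 6,6u+3,c+1,c+2,c+4,c+5\rangle$, $\langle 6,6u+4,6u+8,c+1,c+3,c+5\rangle$, for some integer $u$ with $1\le u\le\frac c6-1$. (ii) If $c\equiv 2\pmod 6$, then $S$ equals one of the following: $\langle 6,6t+2,6t+4,c+1,c+3,c+5\rangle$, $\langle 6,6u+3,c,c+2,c+3,c+5\rangle$, $\langle 6,6u+4,6u+8,c+1,c+3,c+5\rangle$, for some integers $t$ and $u$ with $1\le t\le\frac{c-2}6$ and $1\le u\le\frac{c-2}6-1$. (iii) If $c\equiv 3\pmod 6$, then $S=\langle 6,6t+3,c+1,c+2,c+4,c+5\rangle$ for some integer $t$ with $1\le t\le\frac{c-3}6$. (iv) If $c\equiv 4\pmod 6$, then $S$ equals one of the following: $\langle 6,6t+2,6t+4,c+1,c+3,c+5\rangle$, $\langle 6,6t+4,6t+8,c+1,c+3,c+5\rangle$, for some integer $t$ with $1\le t\le\frac{c-4}6$. (v) If $c\equiv 5\pmod 6$, then $S$ equals one of the following: $\langle 6,c,c+2,c+3,c+4,c+5\rangle$, $\langle 6,6t+3,c,c+2,c+3,c+5\rangle$, for some integer $t$ with $1\le t\le\frac{c-5}6$.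
   Context: A numerical semigroup is a submonoid $S$ of $(\mathbb N,+)$ ($\mathbb N$ the nonnegative integers) with finite complement in $\mathbb N$. Its multiplicity is the least positive integer in $S$, and its conductor is $\max(\mathbb Z\setminus S)+1$. $S$ is an Arf numerical semigroup if $x+y-z\in S$ for all $x,y,z\in S$ with $x\ge y\ge z$. $\langle A\rangle$ denotes the submonoid of $\mathbb N$ generated by $A$. *)

theory Defs
  imports Complex_Main
begin

definition add_submonoid :: "nat set \<Rightarrow> bool" where
  "add_submonoid S \<longleftrightarrow> 0 \<in> S \<and> (\<forall>x\<in>S. \<forall>y\<in>S. x + y \<in> S)"

definition submonoid_gen :: "nat set \<Rightarrow> nat set" where
  "submonoid_gen A = add_submonoid hull A"

definition numerical_semigroup :: "nat set \<Rightarrow> bool" where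
  "numerical_semigroup S \<longleftrightarrow> add_submonoid S \<and> finite (UNIV - S)"

text \<open>Truncated subtraction is harmless here, since \<open>z \<le> x + y\<close>.\<close>

definition arf_numerical_semigroup :: "nat set \<Rightarrow> bool" where
  "arf_numerical_semigroup S \<longleftrightarrow>
     numerical_semigroup S \<and>
     (\<forall>x\<in>S. \<forall>y\<in>S. \<forall>z\<in>S. x \<ge> y \<and> y \<ge> z \<longrightarrow> x + y - z \<in> S)"

definition semigroup_multiplicity :: "nat set \<Rightarrow> nat" where
  "semigroup_multiplicity S = (LEAST n. n \<in> S \<and> 0 < n)"

text \<open>The maximum is taken over the integers outside \<open>S\<close>. As \<open>-1\<close> is one of them, the
  maximum plus one is nonnegative and the conversion to \<^typ>\<open>nat\<close> loses nothing; this is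
  confirmed by the lemma below.\<close>

definition conductor :: "nat set \<Rightarrow> nat" where
  "conductor S = nat ((GREATEST z::int. z \<notin> int ` S) + 1)"

lemma conductor_greatest_gap:
  assumes "numerical_semigroup S"
  shows "int (conductor S) - 1 \<notin> int ` S"
    and "\<And>z. z \<notin> int ` S \<Longrightarrow> z \<le> int (conductor S) - 1"
proof -
  let ?G = "{z::int. z \<notin> int ` S \<and> -1 \<le> z}"
  have "?G \<subseteq> insert (-1) (int ` (UNIV - S))"
  proof
    fix z assume z: "z \<in> ?G"
    show "z \<in> insert (-1) (int ` (UNIV - S))"
    proof (cases "z = -1")
      case False
      with z have "z = int (nat z)" "nat z \<notin> S" by force+
      then show ?thesis by blast
    qed simp
  qed
  moreover have "finite (UNIV - S)"
    using assms by (simp add: numerical_semigroup_def)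
  ultimately have fin: "finite ?G"
    by (meson finite_imageI finite_insert finite_subset)
  have mem: "-1 \<in> ?G" by auto
  have Max_in: "Max ?G \<in> ?G" using Max_in[OF fin] mem by blast
  have ub: "z \<le> Max ?G" if "z \<notin> int ` S" for z
  proof (cases "-1 \<le> z")
    case True
    then show ?thesis using that by (intro Max_ge fin) simp
  next
    case False
    then show ?thesis using Max_in by simp
  qed
  have "(GREATEST z::int. z \<notin> int ` S) = Max ?G"
    by (rule Greatest_equality) (use Max_in ub in auto)
  then have "int (conductor S) - 1 = Max ?G"
    using Max_in by (simp add: conductor_def)
  then show "int (conductor S) - 1 \<notin> int ` S"
    and "\<And>z. z \<notin> int ` S \<Longrightarrow> z \<le> int (conductor S) - 1"
    using Max_in ub by auto
qed

end

theory Submission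
  imports Defs
begin

text \<open>By the Arf condition, \<open>x\<close> and \<open>x + d\<close> in \<open>S\<close> force \<open>x + k d\<close> in \<open>S\<close> for all \<open>k\<close>. Let \<open>s\<close> be
  the least element of \<open>S\<close> not divisible by 6. Comparing \<open>s\<close> with the multiples of 6 next to it,
  one finds that from there on \<open>S\<close> contains all numbers (\<open>s \<equiv> 1, 5\<close>), all multiples of 3
  (\<open>s \<equiv> 3\<close>) or all even numbers (\<open>s \<equiv> 2, 4\<close>). In the last two cases the least element of \<open>S\<close>
  which is not divisible by 3, respectively by 2, has a neighbour in \<open>S\<close>, and this pair of
  consecutive elements determines the conductor. The generators are then read off from the
  least element in each residue class modulo 6.\<close>

section \<open>Generated submonoids and residue classes modulo 6\<close>

lemma submonoid_gen_memI: "a \<in> A \<Longrightarrow> a \<in> submonoid_gen A"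
  unfolding submonoid_gen_def by (meson hull_subset subsetD)

text \<open>Submonoids are closed under intersection, so the hull is itself a submonoid.\<close>

lemma add_submonoid_submonoid_gen: "add_submonoid (submonoid_gen A)"
  unfolding submonoid_gen_def hull_def add_submonoid_def by auto

lemma submonoid_gen_subset: "add_submonoid S \<Longrightarrow> A \<subseteq> S \<Longrightarrow> submonoid_gen A \<subseteq> S"
  unfolding submonoid_gen_def by (rule hull_minimal)

lemma add_submonoid_add_mult:
  assumes "add_submonoid S" "a \<in> S" "m \<in> S"
  shows "a + k * m \<in> S"
proof (induction k)
  case (Suc k)
  then have "(a + k * m) + m \<in> S"
    using assms by (simp add: add_submonoid_def)
  then show ?case by (simp add: algebra_simps)
qed (use assms in simp)

text \<open>An element n of \<open>S\<close> differs from a suitable smaller generator in its class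
  by a multiple of 6, and 6 is a generator. The class of 0 is served by 0. Writing n as
  \<open>6 * p + j\<close> turns each use of \<open>cover\<close> into a finite case split.\<close>

lemma eq_submonoid_gen_6I:
  assumes S: "add_submonoid S" and A: "A \<subseteq> S" and six: "6 \<in> A"
    and cover: "\<And>p j. 6 * p + j \<in> S \<Longrightarrow> j \<in> {1, 2, 3, 4, 5} \<Longrightarrow>
      \<exists>a\<in>A. a \<le> 6 * p + j \<and> a mod 6 = j"
  shows "S = submonoid_gen A"
proof
  show "submonoid_gen A \<subseteq> S" using S A by (rule submonoid_gen_subset)
  show "S \<subseteq> submonoid_gen A"
  proof
    fix n assume "n \<in> S"
    have M: "add_submonoid (submonoid_gen A)" by (rule add_submonoid_submonoid_gen)
    obtain a where a: "a \<in> insert 0 A" "a \<le> n" "a mod 6 = n mod 6"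
    proof (cases "6 dvd n")
      case True
      then show ?thesis using that[of 0] by (simp add: mod_eq_0_iff_dvd)
    next
      case False
      then have "n mod 6 \<in> {1, 2, 3, 4, 5}" by (simp; presburger)
      then show ?thesis using cover[of "n div 6" "n mod 6"] \<open>n \<in> S\<close> that by auto
    qed
    then have "a \<in> submonoid_gen A"
      using M by (auto simp: add_submonoid_def submonoid_gen_memI)
    moreover have "6 dvd n - a"
      using a(2,3) by (metis mod_eq_dvd_iff_nat)
    then obtain k where "n = a + k * 6"
      using a(2) by (metis dvd_div_mult_self le_add_diff_inverse)
    ultimately show "n \<in> submonoid_gen A"
      using add_submonoid_add_mult[OF M] submonoid_gen_memI[OF six] by simp
  qed
qed

text \<open>These rules decide the conditions of divisibility by 6 and 3 once the residue
  \<open>j\<close> is fixed, so that inequalities and parity conditions remain.\<close>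

lemma dvd_6_mult_add:
  fixes p :: nat
  shows "\<not> 6 dvd 6 * p + 1" "\<not> 6 dvd 6 * p + 2" "\<not> 6 dvd 6 * p + 3"
    "\<not> 6 dvd 6 * p + 4" "\<not> 6 dvd 6 * p + 5" "\<not> 3 dvd 6 * p + 1" "\<not> 3 dvd 6 * p + 2"
    "3 dvd 6 * p + 3" "\<not> 3 dvd 6 * p + 4" "\<not> 3 dvd 6 * p + 5"
  by presburger+

section \<open>Generators for the three shapes of membership criterion\<close>

text \<open>Among \<open>c\<close>, ..., \<open>c + 5\<close> the multiple of 6 is \<open>c\<close>
  or \<open>c + 1\<close>, respectively; the other five numbers are the least elements of their
  classes.\<close>

lemma eq_submonoid_gen_full:
  assumes sub: "add_submonoid S" and mem: "\<And>n. n \<in> S \<longleftrightarrow> 6 dvd n \<or> c \<le> n"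
  shows "c mod 6 = 0 \<Longrightarrow> S = submonoid_gen {6, c + 1, c + 2, c + 3, c + 4, c + 5}"
    and "c mod 6 = 5 \<Longrightarrow> S = submonoid_gen {6, c, c + 2, c + 3, c + 4, c + 5}"
proof -
  assume c: "c mod 6 = 0"
  show "S = submonoid_gen {6, c + 1, c + 2, c + 3, c + 4, c + 5}" (is "_ = submonoid_gen ?A")
  proof (rule eq_submonoid_gen_6I[OF sub])
    define q where "q = c div 6"
    have q: "c = 6 * q"
      using c unfolding q_def by presburger
    fix p j assume "6 * p + j \<in> S" "j \<in> {1, 2, 3, 4, 5}"
    then show "\<exists>a\<in>?A. a \<le> 6 * p + j \<and> a mod 6 = j" unfolding mem
      using q
      apply (elim disjE insertE emptyE; simp only: dvd_6_mult_add simp_thms;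
          simp del: One_nat_def add_2_eq_Suc add_2_eq_Suc')
      done
  qed (auto simp: mem)
next
  assume c: "c mod 6 = 5"
  show "S = submonoid_gen {6, c, c + 2, c + 3, c + 4, c + 5}" (is "_ = submonoid_gen ?A")
  proof (rule eq_submonoid_gen_6I[OF sub])
    define q where "q = c div 6"
    have q: "c = 6 * q + 5"
      using c unfolding q_def by presburger
    fix p j assume "6 * p + j \<in> S" "j \<in> {1, 2, 3, 4, 5}"
    \<comment> \<open>For \<open>j < 5\<close> the bound \<open>6 * q + 5 \<le> 6 * p + j\<close>
      forces \<open>q < p\<close>, so \<open>c + j + 1 = 6 * (q + 1) + j\<close> is a suitable
      generator; for \<open>j = 5\<close> it is \<open>c\<close>.\<close>
    then show "\<exists>a\<in>?A. a \<le> 6 * p + j \<and> a mod 6 = j" unfolding mem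
      using q
      apply (elim disjE insertE emptyE; simp only: dvd_6_mult_add simp_thms;
          simp del: One_nat_def add_2_eq_Suc add_2_eq_Suc')
      by presburger+
  qed (auto simp: mem)
qed

text \<open>The class of 3 starts at \<open>6 * t + 3\<close>, which is at most \<open>c\<close>.
  The classes of 1, 2, 4, 5 start with the four numbers among \<open>c\<close>, ...,
  \<open>c + 5\<close> that are not divisible by 3.\<close>

lemma eq_submonoid_gen_triple:
  assumes sub: "add_submonoid S"
    and mem: "\<And>n. n \<in> S \<longleftrightarrow> 6 dvd n \<or> (3 dvd n \<and> 6 * t + 3 \<le> n) \<or> c \<le> n"
  shows "c mod 3 = 0 \<Longrightarrow> 6 * t + 3 \<le> c \<Longrightarrow> S = submonoid_gen {6, 6 * t + 3, c + 1, c + 2, c + 4, c + 5}"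
    and "c mod 3 = 2 \<Longrightarrow> 6 * t + 3 \<le> c \<Longrightarrow> S = submonoid_gen {6, 6 * t + 3, c, c + 2, c + 3, c + 5}"
proof -
  assume c: "c mod 3 = 0" "6 * t + 3 \<le> c"
  show "S = submonoid_gen {6, 6 * t + 3, c + 1, c + 2, c + 4, c + 5}" (is "_ = submonoid_gen ?A")
  proof (rule eq_submonoid_gen_6I[OF sub])
    define q where "q = c div 6"
    have q: "c = 6 * q \<or> c = 6 * q + 3"
      using c(1) unfolding q_def by presburger
    fix p j assume "6 * p + j \<in> S" "j \<in> {1, 2, 3, 4, 5}"
    then show "\<exists>a\<in>?A. a \<le> 6 * p + j \<and> a mod 6 = j" unfolding mem
      using q c(2)
      apply (elim disjE insertE emptyE; simp only: dvd_6_mult_add simp_thms;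
          simp del: One_nat_def add_2_eq_Suc add_2_eq_Suc')
      by presburger+
  qed (auto simp: mem dvd_6_mult_add)
next
  assume c: "c mod 3 = 2" "6 * t + 3 \<le> c"
  show "S = submonoid_gen {6, 6 * t + 3, c, c + 2, c + 3, c + 5}" (is "_ = submonoid_gen ?A")
  proof (rule eq_submonoid_gen_6I[OF sub])
    define q where "q = c div 6"
    have q: "c = 6 * q + 2 \<or> c = 6 * q + 5"
      using c(1) unfolding q_def by presburger
    fix p j assume "6 * p + j \<in> S" "j \<in> {1, 2, 3, 4, 5}"
    then show "\<exists>a\<in>?A. a \<le> 6 * p + j \<and> a mod 6 = j" unfolding mem
      using q c(2)
      apply (elim disjE insertE emptyE; simp only: dvd_6_mult_add simp_thms;
          simp del: One_nat_def add_2_eq_Suc add_2_eq_Suc')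
      by presburger+
  qed (auto simp: mem dvd_6_mult_add)
qed

text \<open>As \<open>c\<close> is even, the odd classes start at \<open>c + 1\<close>,
  \<open>c + 3\<close>, \<open>c + 5\<close>. The even elements from \<open>6 * t + r\<close> on
  give the other two generators; for \<open>r = 4\<close> the second is \<open>6 * t + 8\<close>,
  since \<open>6 * t + 6\<close> is a multiple of 6.\<close>

lemma eq_submonoid_gen_double:
  assumes sub: "add_submonoid S" and c: "even c"
    and mem: "\<And>n. n \<in> S \<longleftrightarrow> 6 dvd n \<or> (even n \<and> 6 * t + r \<le> n) \<or> c \<le> n"
  shows "r = 2 \<Longrightarrow> 6 * t + 2 \<le> c \<Longrightarrow> S = submonoid_gen {6, 6 * t + 2, 6 * t + 4, c + 1, c + 3, c + 5}"
    and "r = 4 \<Longrightarrow> 6 * t + 4 \<le> c \<Longrightarrow> S = submonoid_gen {6, 6 * t + 4, 6 * t + 8, c + 1, c + 3, c + 5}"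
proof -
  assume r: "r = 2" "6 * t + 2 \<le> c"
  show "S = submonoid_gen {6, 6 * t + 2, 6 * t + 4, c + 1, c + 3, c + 5}" (is "_ = submonoid_gen ?A")
  proof (rule eq_submonoid_gen_6I[OF sub])
    define q where "q = c div 6"
    have q: "c = 6 * q \<or> c = 6 * q + 2 \<or> c = 6 * q + 4"
      using c unfolding q_def by presburger
    fix p j assume "6 * p + j \<in> S" "j \<in> {1, 2, 3, 4, 5}"
    then show "\<exists>a\<in>?A. a \<le> 6 * p + j \<and> a mod 6 = j" unfolding mem r(1)
      using q r(2)
      apply (elim disjE insertE emptyE; simp only: dvd_6_mult_add simp_thms;
          simp del: One_nat_def add_2_eq_Suc add_2_eq_Suc')
      by presburger+
  qed (auto simp: mem r dvd_6_mult_add)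
next
  assume r: "r = 4" "6 * t + 4 \<le> c"
  show "S = submonoid_gen {6, 6 * t + 4, 6 * t + 8, c + 1, c + 3, c + 5}" (is "_ = submonoid_gen ?A")
  proof (rule eq_submonoid_gen_6I[OF sub])
    define q where "q = c div 6"
    have q: "c = 6 * q \<or> c = 6 * q + 2 \<or> c = 6 * q + 4"
      using c unfolding q_def by presburger
    fix p j assume "6 * p + j \<in> S" "j \<in> {1, 2, 3, 4, 5}"
    then show "\<exists>a\<in>?A. a \<le> 6 * p + j \<and> a mod 6 = j" unfolding mem r(1)
      using q r(2)
      apply (elim disjE insertE emptyE; simp only: dvd_6_mult_add simp_thms;
          simp del: One_nat_def add_2_eq_Suc add_2_eq_Suc')
      by presburger+
  qed (auto simp: mem r dvd_6_mult_add)
qed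

section \<open>Conductor, Arf progressions and least elements\<close>

lemma conductor_le_imp_mem:
  assumes "numerical_semigroup S" "conductor S \<le> n"
  shows "n \<in> S"
proof (rule ccontr)
  assume "n \<notin> S"
  then have "int n \<notin> int ` S" by auto
  then show False using conductor_greatest_gap(2)[OF assms(1)] assms(2) by force
qed

lemma conductor_eqI:
  assumes S: "numerical_semigroup S" and gap: "n \<notin> S" and above: "\<And>k. n < k \<Longrightarrow> k \<in> S"
  shows "conductor S = Suc n"
proof (rule antisym)
  show "conductor S \<le> Suc n"
  proof (rule ccontr)
    assume *: "\<not> conductor S \<le> Suc n"
    then have "conductor S - 1 \<in> S" by (intro above) simp
    then have "int (conductor S - 1) \<in> int ` S" by blast
    then show False using conductor_greatest_gap(1)[OF S] * by (simp add: of_nat_diff)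
  qed
  show "Suc n \<le> conductor S"
    using conductor_le_imp_mem[OF S] gap by (meson not_less_eq_eq)
qed

text \<open>The Arf condition for \<open>x + k * d\<close>, \<open>x + d\<close> and
  \<open>x\<close> yields \<open>x + (k + 1) * d\<close>. The required order holds for
  \<open>k \<ge> 1\<close>, which is why \<open>k = 0\<close> is treated separately.\<close>

lemma arf_progression:
  assumes arf: "arf_numerical_semigroup S" and x: "x \<in> S" and y: "x + d \<in> S"
  shows "x + k * d \<in> S"
proof (induction k)
  case (Suc k)
  show ?case
  proof (cases k)
    case 0
    then show ?thesis using y by simp
  next
    case (Suc j)
    have "(x + k * d) + (x + d) - x \<in> S"
      using arf x y Suc.IH Suc unfolding arf_numerical_semigroup_def
      by (metis add_le_cancel_left le_add1 mult_Suc)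
    then show ?thesis by (simp add: algebra_simps)
  qed
qed (use x in simp)

text \<open>When \<open>d\<close> divides \<open>x\<close>, the progression consists of all
  multiples of \<open>d\<close> from \<open>x\<close> on. It is applied with \<open>d\<close> equal
  to 1, 2 and 3.\<close>

lemma arf_progression_dvd:
  assumes "arf_numerical_semigroup S" "x \<in> S" "x + d \<in> S" "d dvd x" "d dvd n" "x \<le> n"
  shows "n \<in> S"
proof -
  obtain k where "n = x + k * d"
    using assms by (metis dvd_diff_nat dvd_div_mult_self le_add_diff_inverse)
  then show ?thesis using arf_progression[OF assms(1-3)] by simp
qed

lemma arf_consecutive:
  assumes "arf_numerical_semigroup S" "x \<in> S" "Suc x \<in> S" "x \<le> n"
  shows "n \<in> S"
  using arf_progression_dvd[of S x 1 n] assms by simp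

lemma numerical_semigroup_nondivisible:
  assumes "numerical_semigroup S" "1 < d"
  obtains v where "v \<in> S" "\<not> d dvd v" "\<And>n. n \<in> S \<Longrightarrow> n < v \<Longrightarrow> d dvd n"
proof -
  let ?c = "conductor S"
  \<comment> \<open>This witness leaves remainder 1 modulo \<open>d\<close> and is at least the
    conductor.\<close>
  have "\<not> d dvd Suc (d * ?c)"
    using assms(2) by (metis dvd_add_right_iff dvd_triv_left nat_dvd_1_iff_1 less_irrefl Suc_eq_plus1)
  moreover have "?c \<le> Suc (d * ?c)" using assms(2) by (cases d) auto
  then have "Suc (d * ?c) \<in> S" by (rule conductor_le_imp_mem[OF assms(1)])
  ultimately have "\<exists>v. v \<in> S \<and> \<not> d dvd v" by blast
  from exists_least_iff[THEN iffD1, OF this] show thesis using that by blast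
qed

lemma semigroup_multiplicity_mem:
  assumes "numerical_semigroup S"
  shows "semigroup_multiplicity S \<in> S" "0 < semigroup_multiplicity S"
proof -
  have "Suc (conductor S) \<in> S \<and> 0 < Suc (conductor S)"
    using conductor_le_imp_mem[OF assms] by simp
  from LeastI[of "\<lambda>n. n \<in> S \<and> 0 < n", OF this]
  show "semigroup_multiplicity S \<in> S" "0 < semigroup_multiplicity S"
    by (auto simp: semigroup_multiplicity_def)
qed

lemma semigroup_multiplicity_le: "n \<in> S \<Longrightarrow> 0 < n \<Longrightarrow> semigroup_multiplicity S \<le> n"
  unfolding semigroup_multiplicity_def by (simp add: Least_le)

section \<open>Classification by the least element not divisible by 6\<close>

text \<open>The shapes belong to the residues 1 and 5, 3, and 2 and 4 of the least element
  \<open>s\<close> not divisible by 6. In the last two shapes \<open>6 * t + 3\<close> and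
  \<open>6 * t + r\<close> are \<open>s\<close> itself.\<close>

lemma arf_multiplicity_6_cases:
  assumes arf: "arf_numerical_semigroup S" and mult: "semigroup_multiplicity S = 6"
  defines "c \<equiv> conductor S"
  obtains
    (full) "c mod 6 \<in> {0, 5}" "6 \<le> c"
      "\<And>n. n \<in> S \<longleftrightarrow> 6 dvd n \<or> c \<le> n"
  | (triple) t where "1 \<le> t" "6 * t + 3 \<le> c" "c mod 3 \<in> {0, 2}"
      "\<And>n. n \<in> S \<longleftrightarrow> 6 dvd n \<or> (3 dvd n \<and> 6 * t + 3 \<le> n) \<or> c \<le> n"
  | (double) t r where "1 \<le> t" "r \<in> {2, 4}" "6 * t + r \<le> c" "even c"
      "\<And>n. n \<in> S \<longleftrightarrow> 6 dvd n \<or> (even n \<and> 6 * t + r \<le> n) \<or> c \<le> n"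
proof -
  have ns: "numerical_semigroup S" and sub: "add_submonoid S"
    using arf by (auto simp: arf_numerical_semigroup_def numerical_semigroup_def)
  have six: "n \<in> S" if "6 dvd n" for n
  proof -
    obtain k where "n = 6 * k" using \<open>6 dvd n\<close> by (rule dvdE)
    moreover have "0 \<in> S" "6 \<in> S"
      using sub semigroup_multiplicity_mem(1)[OF ns] mult by (auto simp: add_submonoid_def)
    ultimately show ?thesis
      using add_submonoid_add_mult[OF sub, of 0 6 k] by (simp add: mult.commute)
  qed
  have above: "n \<in> S" if "c \<le> n" for n
    using conductor_le_imp_mem[OF ns] that c_def by simp
  have c_eq: "c = k" if "0 < k" "k - 1 \<notin> S" "\<And>n. k \<le> n \<Longrightarrow> n \<in> S" for k
    using conductor_eqI[OF ns that(2)] that c_def by force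
  obtain s where s: "s \<in> S" "\<not> 6 dvd s" and s_min: "\<And>n. n \<in> S \<Longrightarrow> n < s \<Longrightarrow> 6 dvd n"
    using numerical_semigroup_nondivisible[OF ns, of 6] by auto
  \<comment> \<open>Positive elements are at least the multiplicity 6, and 0 and 6 are divisible by
    6.\<close>
  have "6 < s" using semigroup_multiplicity_le[OF s(1)] mult s(2) by (cases "s = 6"; cases "s = 0") auto
  define t where "t = s div 6"
  have t: "1 \<le> t" using \<open>6 < s\<close> by (simp add: t_def)
  have low: "n < s \<Longrightarrow> n \<in> S \<longleftrightarrow> 6 dvd n" for n using s_min six by blast
  have even_case: thesis if r: "s = 6 * t + r" "r \<in> {2, 4}"
    and mem2: "\<And>n. even n \<Longrightarrow> s \<le> n \<Longrightarrow> n \<in> S" for r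
  proof -
    have "even s" using r by auto
    obtain v where v: "v \<in> S" "odd v" and v_min: "\<And>n. n \<in> S \<Longrightarrow> n < v \<Longrightarrow> even n"
      using numerical_semigroup_nondivisible[OF ns, of 2] by auto
    have "s < v"
    proof (rule ccontr)
      assume "\<not> s < v"
      with v \<open>even s\<close> have "v < s" by (cases "v = s") auto
      with low v(1) have "6 dvd v" by blast
      with v(2) show False by presburger
    qed
    \<comment> \<open>The even number \<open>v - 1\<close> is at least \<open>s\<close>, hence in
      \<open>S\<close>, and forms a consecutive pair with \<open>v\<close>. The odd number
      \<open>v - 2\<close> is a gap by minimality of \<open>v\<close>, so the conductor is
      \<open>v - 1\<close>.\<close>
    have "even (v - 1)" "odd (v - 1 - 1)" using v(2) \<open>s < v\<close> \<open>6 < s\<close> by auto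
    then have all: "n \<in> S" if "v - 1 \<le> n" for n
      using arf_consecutive[OF arf mem2[of "v - 1"]] that \<open>s < v\<close> v(1) by simp
    have "v - 1 - 1 \<notin> S"
      using v_min[of "v - 1 - 1"] \<open>odd (v - 1 - 1)\<close> \<open>s < v\<close> by auto
    then have c: "c = v - 1" using all \<open>s < v\<close> \<open>6 < s\<close> by (intro c_eq) auto
    have "n \<in> S \<longleftrightarrow> 6 dvd n \<or> (even n \<and> s \<le> n) \<or> c \<le> n" for n
    proof
      assume "n \<in> S"
      show "6 dvd n \<or> (even n \<and> s \<le> n) \<or> c \<le> n"
        using low[of n] v_min[of n] \<open>n \<in> S\<close> c by linarith
    qed (use six mem2 above in blast)
    then show thesis using t r c \<open>even (v - 1)\<close> \<open>s < v\<close> by (intro double) auto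
  qed
  have "s = 6 * t + 1 \<or> s = 6 * t + 5 \<or> s = 6 * t + 3 \<or> s = 6 * t + 2 \<or> s = 6 * t + 4"
    using s(2) unfolding t_def by presburger
  then show thesis
  proof (elim disjE)
    assume 1: "s = 6 * t + 1"
    \<comment> \<open>The consecutive pair is \<open>6 * t\<close>, \<open>s\<close>, and
      \<open>6 * t - 1\<close> is the last gap.\<close>
    have all: "n \<in> S" if "6 * t \<le> n" for n
      using arf_consecutive[OF arf six[of "6 * t"]] s that 1 by simp
    have "\<not> 6 dvd 6 * t - 1" using t by presburger
    then have c: "c = 6 * t" using t 1 all low[of "6 * t - 1"] by (intro c_eq) auto
    have "n \<in> S \<longleftrightarrow> 6 dvd n \<or> c \<le> n" for n
      using low[of n] six[of n] above[of n] c 1 by linarith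
    then show thesis using t c by (intro full) auto
  next
    assume 5: "s = 6 * t + 5"
    \<comment> \<open>Here the multiple of 6 follows \<open>s\<close>, so the conductor is
      \<open>s\<close> itself.\<close>
    have "6 dvd Suc s" using 5 by presburger
    then have all: "n \<in> S" if "s \<le> n" for n
      using arf_consecutive[OF arf s(1) six] that by blast
    have "\<not> 6 dvd s - 1" using 5 by presburger
    then have c: "c = s" using 5 all low[of "s - 1"] by (intro c_eq) auto
    have "n \<in> S \<longleftrightarrow> 6 dvd n \<or> c \<le> n" for n
      using low[of n] six[of n] above[of n] c by linarith
    moreover have "s mod 6 = 5" using 5 by presburger
    ultimately show thesis using t 5 c by (intro full) auto
  next
    assume 3: "s = 6 * t + 3"
    \<comment> \<open>The next multiple of 6 is at distance 3, which gives a progression of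
      difference 3.\<close>
    have "6 dvd s + 3" "3 dvd s" using 3 by presburger+
    then have mem3: "n \<in> S" if "3 dvd n" "s \<le> n" for n
      using arf_progression_dvd[OF arf s(1) six] that by blast
    obtain v where v: "v \<in> S" "\<not> 3 dvd v" and v_min: "\<And>n. n \<in> S \<Longrightarrow> n < v \<Longrightarrow> 3 dvd n"
      using numerical_semigroup_nondivisible[OF ns, of 3] by auto
    have "s < v"
    proof (rule ccontr)
      assume "\<not> s < v"
      with v \<open>3 dvd s\<close> have "v < s" by (cases "v = s") auto
      with low v(1) have "6 dvd v" by blast
      with v(2) show False by presburger
    qed
    \<comment> \<open>Of the two neighbours of \<open>v\<close> one is a multiple of 3 and lies in
      \<open>S\<close>. If it is \<open>v - 1\<close>, then \<open>c = v - 1\<close>; if it is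
      \<open>v + 1\<close>, then \<open>c = v\<close>. The bound \<open>c \<le> v\<close> ensures
      that elements below \<open>c\<close> are multiples of 3.\<close>
    have c: "c mod 3 \<in> {0, 2} \<and> s \<le> c \<and> c \<le> v \<and> v \<le> Suc c \<and> (3 dvd c \<or> c = v)"
    proof (cases "3 dvd v - 1")
      case True
      have all: "n \<in> S" if "v - 1 \<le> n" for n
        using arf_consecutive[OF arf mem3[OF True]] that \<open>s < v\<close> v(1) by simp
      have "\<not> 3 dvd v - 1 - 1" using True \<open>s < v\<close> 3 by presburger
      then have "v - 1 - 1 \<notin> S" using v_min[of "v - 1 - 1"] \<open>s < v\<close> by auto
      then have "c = v - 1" using all \<open>s < v\<close> 3 by (intro c_eq) auto
      then show ?thesis using True \<open>s < v\<close> by (simp add: mod_eq_0_iff_dvd)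
    next
      case False
      then have "3 dvd Suc v" using v(2) by presburger
      then have all: "n \<in> S" if "v \<le> n" for n
        using arf_consecutive[OF arf v(1) mem3] that \<open>s < v\<close> by simp
      have "v - 1 \<notin> S" using v_min[of "v - 1"] False \<open>s < v\<close> by auto
      then have "c = v" using all \<open>s < v\<close> by (intro c_eq) auto
      moreover have "v mod 3 = 2" using v(2) False by presburger
      ultimately show ?thesis using \<open>s < v\<close> by simp
    qed
    have "n \<in> S \<longleftrightarrow> 6 dvd n \<or> (3 dvd n \<and> s \<le> n) \<or> c \<le> n" for n
    proof
      assume "n \<in> S"
      show "6 dvd n \<or> (3 dvd n \<and> s \<le> n) \<or> c \<le> n"
        using low[of n] v_min[of n] \<open>n \<in> S\<close> c by linarith
    qed (use six mem3 above in blast)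
    then show thesis using t c 3 by (intro triple) auto
  next
    assume 2: "s = 6 * t + 2"
    \<comment> \<open>The progression of difference 2 starts at the multiple \<open>6 * t\<close>
      just below \<open>s\<close>; for residue 4 it starts at \<open>s\<close> and uses the multiple
      \<open>s + 2\<close>.\<close>
    then have mem2: "n \<in> S" if "even n" "s \<le> n" for n
      using arf_progression_dvd[OF arf six[of "6 * t"], of 2 n] s(1) that by simp
    show thesis using 2 mem2 by (intro even_case) auto
  next
    assume 4: "s = 6 * t + 4"
    have "6 dvd s + 2" "even s" using 4 by presburger+
    then have mem2: "n \<in> S" if "even n" "s \<le> n" for n
      using arf_progression_dvd[OF arf s(1) six] that by blast
    show thesis using 4 mem2 by (intro even_case) auto
  qed
qed

section \<open>Distribution of the shapes over the residues of the conductor\<close>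

theorem proposition22:
  fixes S :: "nat set" and c :: nat
  assumes "arf_numerical_semigroup S"
    and "semigroup_multiplicity S = 6"
    and "c = conductor S"
  shows
    "(c mod 6 = 0 \<longrightarrow>
        S = submonoid_gen {6, c + 1, c + 2, c + 3, c + 4, c + 5} \<or>
        (\<exists>u::nat. 1 \<le> u \<and> real u \<le> real c / 6 - 1 \<and>
          (S = submonoid_gen {6, 6 * u + 2, 6 * u + 4, c + 1, c + 3, c + 5} \<or>
           S = submonoid_gen {6, 6 * u + 3, c + 1, c + 2, c + 4, c + 5} \<or>
           S = submonoid_gen {6, 6 * u + 4, 6 * u + 8, c + 1, c + 3, c + 5}))) \<and>
     (c mod 6 = 2 \<longrightarrow>
        (\<exists>t::nat. 1 \<le> t \<and> real t \<le> (real c - 2) / 6 \<and>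
          S = submonoid_gen {6, 6 * t + 2, 6 * t + 4, c + 1, c + 3, c + 5}) \<or>
        (\<exists>u::nat. 1 \<le> u \<and> real u \<le> (real c - 2) / 6 - 1 \<and>
          (S = submonoid_gen {6, 6 * u + 3, c, c + 2, c + 3, c + 5} \<or>
           S = submonoid_gen {6, 6 * u + 4, 6 * u + 8, c + 1, c + 3, c + 5}))) \<and>
     (c mod 6 = 3 \<longrightarrow>
        (\<exists>t::nat. 1 \<le> t \<and> real t \<le> (real c - 3) / 6 \<and>
          S = submonoid_gen {6, 6 * t + 3, c + 1, c + 2, c + 4, c + 5})) \<and>
     (c mod 6 = 4 \<longrightarrow>
        (\<exists>t::nat. 1 \<le> t \<and> real t \<le> (real c - 4) / 6 \<and>
          (S = submonoid_gen {6, 6 * t + 2, 6 * t + 4, c + 1, c + 3, c + 5} \<or>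
           S = submonoid_gen {6, 6 * t + 4, 6 * t + 8, c + 1, c + 3, c + 5}))) \<and>
     (c mod 6 = 5 \<longrightarrow>
        S = submonoid_gen {6, c, c + 2, c + 3, c + 4, c + 5} \<or>
        (\<exists>t::nat. 1 \<le> t \<and> real t \<le> (real c - 5) / 6 \<and>
          S = submonoid_gen {6, 6 * t + 3, c, c + 2, c + 3, c + 5}))"
proof -
  have sub: "add_submonoid S"
    using assms(1) by (simp add: arf_numerical_semigroup_def numerical_semigroup_def)
  from assms(1,2) show ?thesis
  proof (cases rule: arf_multiplicity_6_cases)
    case full
    have "c mod 6 = 0 \<or> c mod 6 = 5" using full(1) assms(3) by auto
    then show ?thesis
      using eq_submonoid_gen_full[OF sub full(3)[folded assms(3)]] by auto
  next
    case (triple t)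
    have t: "1 \<le> t" and c: "c mod 3 = 0 \<or> c mod 3 = 2" "6 * t + 3 \<le> c"
      using triple(1-3) assms(3) by auto
    note gen = eq_submonoid_gen_triple[OF sub triple(4)[folded assms(3)] _ c(2)]
    have "c mod 6 = 0 \<or> c mod 6 = 2 \<or> c mod 6 = 3 \<or> c mod 6 = 5"
      using c(1) by presburger
    then show ?thesis
    proof (elim disjE)
      assume m: "c mod 6 = 0"
      have "c mod 3 = 0" using m by presburger
      \<comment> \<open>The residue of \<open>c\<close> sharpens \<open>6 * t + 3 \<le> c\<close> to
        the next number in its class; for residues 0 and 2 this costs a full step in the range of
        the parameter.\<close>
      have "6 * t + 6 \<le> c" using m c(2) by presburger
      then have "real t \<le> real c / 6 - 1" by (auto simp: field_simps)
      then show ?thesis using m t gen(1)[OF \<open>c mod 3 = 0\<close>] by auto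
    next
      assume m: "c mod 6 = 2"
      have "c mod 3 = 2" using m by presburger
      have "6 * t + 8 \<le> c" using m c(2) by presburger
      then have "real t \<le> (real c - 2) / 6 - 1" by (auto simp: field_simps)
      then show ?thesis using m t gen(2)[OF \<open>c mod 3 = 2\<close>] by auto
    next
      assume m: "c mod 6 = 3"
      have "c mod 3 = 0" using m by presburger
      moreover have "real t \<le> (real c - 3) / 6" using c(2) by (auto simp: field_simps)
      ultimately show ?thesis using m t gen(1) by auto
    next
      assume m: "c mod 6 = 5"
      have "c mod 3 = 2" using m by presburger
      have "6 * t + 5 \<le> c" using m c(2) by presburger
      then have "real t \<le> (real c - 5) / 6" by (auto simp: field_simps)
      then show ?thesis using m t gen(2)[OF \<open>c mod 3 = 2\<close>] by auto
    qed
  next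
    case (double t r)
    have t: "1 \<le> t" and c: "even c" "6 * t + r \<le> c" and r: "r = 2 \<or> r = 4"
      using double(1-4) assms(3) by auto
    note gen = eq_submonoid_gen_double[OF sub c(1) double(5)[folded assms(3)]]
    have two: "S = submonoid_gen {6, 6 * t + 2, 6 * t + 4, c + 1, c + 3, c + 5}" if "r = 2"
      using gen(1) that c(2) by simp
    have four: "S = submonoid_gen {6, 6 * t + 4, 6 * t + 8, c + 1, c + 3, c + 5}" if "r = 4"
      using gen(2) that c(2) by simp
    have "c mod 6 = 0 \<or> c mod 6 = 2 \<or> c mod 6 = 4" using c(1) by presburger
    then show ?thesis
    proof (elim disjE)
      assume m: "c mod 6 = 0"
      then have "6 * t + 6 \<le> c" using c(2) r by presburger
      then have "real t \<le> real c / 6 - 1" by (auto simp: field_simps)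
      then show ?thesis using m t r two four by auto
    next
      assume m: "c mod 6 = 2"
      have "real t \<le> (real c - 2) / 6" using c(2) r by (auto simp: field_simps)
      \<comment> \<open>For \<open>c\<close> congruent to 2, \<open>r = 2\<close> allows
        \<open>c = 6 * t + 2\<close>, whereas \<open>r = 4\<close> forces
        \<open>c \<ge> 6 * t + 8\<close>. Hence the two different ranges.\<close>
      moreover have "real t \<le> (real c - 2) / 6 - 1" if "r = 4"
      proof -
        have "6 * t + 8 \<le> c" using m c(2) that by presburger
        then show ?thesis by (simp add: field_simps)
      qed
      ultimately show ?thesis using m t r two four by auto
    next
      assume m: "c mod 6 = 4"
      then have "6 * t + 4 \<le> c" using c(2) r by presburger
      then have "real t \<le> (real c - 4) / 6" by (auto simp: field_simps)
      then show ?thesis using m t r two four by auto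
    qed
  qed
qed

end
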